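(* Let $K$ be the poset of all compositions (finite sequences of positive integers, including the empty composition $\varepsilon$), ordered by $\gamma\le\kappa$ iff $\gamma_i\le\kappa_i$ for all $i$, where $\gamma_i=0$ (resp. $\kappa_i=0$) when $i$ exceeds the number of parts of $\gamma$ (resp. $\kappa$). For $\kappa\in K$ let $K(\kappa)=\{\gamma\in K:\gamma\le\kappa\}$ and $f^{K(\kappa)}(q)=\sum_{\gamma\in K(\kappa)}q^{|\gamma|}$, where $|\gamma|$ is the sum of the parts of $\gamma$. (a) If $\kappa=(\kappa_1,\ldots,\kappa_s)\ne\varepsilon$, $l=\kappa_1$ and $\gamma=(\kappa_2,\ldots,\kappa_s)$, then $f^{K(\kappa)}=1+q\,[l]\,f^{K(\gamma)}$, where $[l]=1+q+\cdots+q^{l-1}$. (b) For every composition $\kappa$, the polynomial $f^{K(\kappa)}$ is unimodal.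
   Context: A polynomial is unimodal if its coefficient sequence $a_0,\ldots,a_r$ satisfies $a_0\le\cdots\le a_m\ge a_{m+1}\ge\cdots\ge a_r$ for some index $m$. $K$ is graded by $|\gamma|$, so $f^{K(\kappa)}$ is the rank generating function of $K(\kappa)$. *)

theory Defs
  imports "HOL-Computational_Algebra.Polynomial" "HOL-Library.More_List"
begin

text \<open>
  A composition is a list of positive natural numbers; the empty list is the empty composition.
\<close>

definition compositions :: "nat list set" where
  "compositions = {\<kappa>. \<forall>x\<in>set \<kappa>. 0 < x}"

text \<open>
  \<open>nth_default 0\<close> pads a composition with zeros beyond its last part; indices start at 0.
\<close>

definition comp_le :: "nat list \<Rightarrow> nat list \<Rightarrow> bool" where
  "comp_le \<gamma> \<kappa> \<longleftrightarrow> (\<forall>i. nth_default 0 \<gamma> i \<le> nth_default 0 \<kappa> i)"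

definition lower_set :: "nat list \<Rightarrow> nat list set" where
  "lower_set \<kappa> = {\<gamma> \<in> compositions. comp_le \<gamma> \<kappa>}"

text \<open>
  The sum ranges over a finite set, see \<open>finite_lower_set\<close> below.
\<close>

definition rank_gen_poly :: "nat list \<Rightarrow> int poly" where
  "rank_gen_poly \<kappa> = (\<Sum>\<gamma>\<in>lower_set \<kappa>. monom 1 (sum_list \<gamma>))"

definition q_int :: "nat \<Rightarrow> int poly" where
  "q_int l = (\<Sum>i<l. monom 1 i)"

definition unimodal :: "'a::{zero,linorder} poly \<Rightarrow> bool" where
  "unimodal p \<longleftrightarrow> (\<exists>m\<le>degree p.
     (\<forall>i<m. coeff p i \<le> coeff p (Suc i)) \<and>
     (\<forall>i. m \<le> i \<and> i < degree p \<longrightarrow> coeff p (Suc i) \<le> coeff p i))"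

lemma comp_le_refl: "comp_le \<kappa> \<kappa>"
  by (simp add: comp_le_def)

lemma comp_le_trans: "comp_le \<alpha> \<beta> \<Longrightarrow> comp_le \<beta> \<gamma> \<Longrightarrow> comp_le \<alpha> \<gamma>"
  unfolding comp_le_def using order_trans by blast

lemma comp_le_length:
  assumes "\<gamma> \<in> compositions" "comp_le \<gamma> \<kappa>"
  shows "length \<gamma> \<le> length \<kappa>"
proof (rule ccontr)
  assume a: "\<not> length \<gamma> \<le> length \<kappa>"
  then have "0 < \<gamma> ! length \<kappa>"
    using assms(1) by (auto simp: compositions_def)
  moreover have "nth_default 0 \<gamma> (length \<kappa>) \<le> nth_default 0 \<kappa> (length \<kappa>)"
    using assms(2) unfolding comp_le_def by blast
  ultimately show False
    using a by (simp add: nth_default_def)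
qed

lemma comp_le_antisym:
  assumes "\<gamma> \<in> compositions" "\<kappa> \<in> compositions" "comp_le \<gamma> \<kappa>" "comp_le \<kappa> \<gamma>"
  shows "\<gamma> = \<kappa>"
proof (rule nth_equalityI)
  show len: "length \<gamma> = length \<kappa>"
    using assms comp_le_length by (meson le_antisym)
  have "nth_default 0 \<gamma> i = nth_default 0 \<kappa> i" for i
    using assms(3,4) unfolding comp_le_def by (meson le_antisym)
  then show "\<gamma> ! i = \<kappa> ! i" if "i < length \<gamma>" for i
    using that len by (metis nth_default_nth)
qed

lemma finite_lower_set: "finite (lower_set \<kappa>)"
proof (rule finite_subset)
  show "lower_set \<kappa> \<subseteq> {xs. set xs \<subseteq> {..sum_list \<kappa>} \<and> length xs \<le> length \<kappa>}"
  proof (clarsimp simp: lower_set_def comp_le_length)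
    fix \<gamma> x assume \<gamma>: "comp_le \<gamma> \<kappa>" and "x \<in> set \<gamma>"
    then obtain i where i: "i < length \<gamma>" "x = \<gamma> ! i"
      by (auto simp: in_set_conv_nth)
    then have "x \<le> nth_default 0 \<kappa> i"
      using \<gamma> unfolding comp_le_def by (metis nth_default_nth)
    also have "\<dots> \<le> sum_list \<kappa>"
      by (simp add: nth_default_def member_le_sum_list)
    finally show "x \<le> sum_list \<kappa>" .
  qed
  show "finite {xs. set xs \<subseteq> {..sum_list \<kappa>} \<and> length xs \<le> length \<kappa>}"
    by (rule finite_lists_length_le) simp
qed

end

theory Submission
  imports Defs
begin

text \<open>
  The recursion (a) splits off the first part. For (b), the coefficients of \<open>[l] p\<close> are sums over
  windows of \<open>l\<close> consecutive coefficients of \<open>p\<close>, so their consecutive differences are the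
  differences of coefficients of \<open>p\<close> at distance \<open>l\<close>. If \<open>p\<close> is unimodal, these differences
  cannot become positive again once they have been negative. Multiplying by \<open>q\<close> and adding \<open>1\<close>
  prepends the coefficient \<open>1\<close>, which does not exceed the next one, also \<open>1\<close>.
\<close>

lemma lower_set_Nil: "lower_set [] = {[]}"
proof -
  have "\<gamma> = []" if "\<gamma> \<in> compositions" "comp_le \<gamma> []" for \<gamma>
    using comp_le_length[OF that] by simp
  then show ?thesis
    by (auto simp: lower_set_def compositions_def comp_le_refl)
qed

lemma comp_le_Cons: "comp_le (i # \<delta>) (l # \<gamma>) \<longleftrightarrow> i \<le> l \<and> comp_le \<delta> \<gamma>"
  unfolding comp_le_def
  by (metis nth_default_Cons_0 nth_default_Cons_Suc not0_implies_Suc)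

lemma Cons_in_lower_set_Cons:
  "i # \<delta> \<in> lower_set (l # \<gamma>) \<longleftrightarrow> 0 < i \<and> i \<le> l \<and> \<delta> \<in> lower_set \<gamma>"
  by (auto simp: lower_set_def compositions_def comp_le_Cons)

lemma Nil_in_lower_set: "[] \<in> lower_set \<kappa>"
  by (simp add: lower_set_def compositions_def comp_le_def)

text \<open>The first part is written \<open>Suc i\<close> with \<open>i < l\<close>, so that
  \<open>i\<close> runs over the exponents in \<open>q_int l\<close> and the shift by one yields the
  factor \<open>q\<close> in (a). The empty composition yields the summand 1.\<close>

lemma lower_set_Cons:
  "lower_set (l # \<gamma>) = insert [] ((\<lambda>(i, \<delta>). Suc i # \<delta>) ` ({..<l} \<times> lower_set \<gamma>))"
  (is "_ = ?R")
proof (rule set_eqI)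
  fix \<alpha>
  show "\<alpha> \<in> lower_set (l # \<gamma>) \<longleftrightarrow> \<alpha> \<in> ?R"
  proof (cases \<alpha>)
    case Nil
    then show ?thesis by (simp add: Nil_in_lower_set)
  next
    case (Cons i \<delta>)
    then show ?thesis
      by (cases i) (auto simp: Cons_in_lower_set_Cons)
  qed
qed

lemma rank_gen_poly_Nil: "rank_gen_poly [] = 1"
  by (simp add: rank_gen_poly_def lower_set_Nil)

lemma rank_gen_poly_Cons:
  "rank_gen_poly (l # \<gamma>) = 1 + monom 1 1 * q_int l * rank_gen_poly \<gamma>"
proof -
  let ?f = "\<lambda>(i, \<delta>). Suc i # \<delta>" and ?S = "{..<l} \<times> lower_set \<gamma>"
  have "inj_on ?f ?S"
    by (auto simp: inj_on_def)
  then have "(\<Sum>\<alpha>\<in>?f ` ?S. monom 1 (sum_list \<alpha>) :: int poly)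
      = (\<Sum>(i, \<delta>)\<in>?S. monom 1 (Suc i + sum_list \<delta>))"
    by (simp add: sum.reindex case_prod_unfold)
  also have "\<dots> = (\<Sum>(i, \<delta>)\<in>?S. monom 1 1 * (monom 1 i * monom 1 (sum_list \<delta>)))"
    by (simp add: mult_monom)
  also have "\<dots> = monom 1 1 * (\<Sum>(i, \<delta>)\<in>?S. monom 1 i * monom 1 (sum_list \<delta>))"
    by (simp add: sum_distrib_left case_prod_unfold)
  also have "(\<Sum>(i, \<delta>)\<in>?S. monom 1 i * monom 1 (sum_list \<delta>)) = q_int l * rank_gen_poly \<gamma>"
    by (simp add: q_int_def rank_gen_poly_def sum_product sum.cartesian_product)
  finally show ?thesis
    unfolding rank_gen_poly_def[of "l # \<gamma>"] lower_set_Cons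
    by (subst sum.insert) (auto simp: finite_lower_set mult.assoc)
qed

lemma coeff_rank_gen_poly_nonneg: "0 \<le> coeff (rank_gen_poly \<kappa>) n"
  by (simp add: rank_gen_poly_def coeff_sum sum_nonneg)

lemma coeff_0_rank_gen_poly: "coeff (rank_gen_poly \<kappa>) 0 = 1"
  by (cases \<kappa>) (simp_all add: rank_gen_poly_Nil rank_gen_poly_Cons coeff_monom_mult mult.assoc)

text \<open>The mode is the first strict descent. Minimality gives the ascent before it, and the
  assumption gives the descent after it.\<close>

lemma unimodalI:
  assumes "\<And>i j. \<lbrakk>i < j; coeff p (Suc i) < coeff p i\<rbrakk> \<Longrightarrow> coeff p (Suc j) \<le> coeff p j"
  shows "unimodal p"
proof -
  \<comment> \<open>The first disjunct makes the least index exist and bounds it by the degree, even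
    if no strict descent occurs.\<close>
  let ?P = "\<lambda>i. i = degree p \<or> coeff p (Suc i) < coeff p i"
  define m where "m = (LEAST i. ?P i)"
  have P: "?P m"
    unfolding m_def by (rule LeastI[of ?P "degree p"]) simp
  have "m \<le> degree p"
    unfolding m_def by (rule Least_le) simp
  moreover have "coeff p i \<le> coeff p (Suc i)" if "i < m" for i
    using not_less_Least[of i ?P] that by (auto simp: m_def)
  moreover have "coeff p (Suc i) \<le> coeff p i" if "m \<le> i" "i < degree p" for i
    using P assms[of m i] that by (cases "i = m") auto
  ultimately show ?thesis
    unfolding unimodal_def by blast
qed

lemma unimodalE:
  assumes "unimodal p" "\<And>n. 0 \<le> coeff p n"
  obtains m where "\<And>i j. \<lbrakk>i \<le> j; j \<le> m\<rbrakk> \<Longrightarrow> coeff p i \<le> coeff p j"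
    and "\<And>i j. \<lbrakk>m \<le> i; i \<le> j\<rbrakk> \<Longrightarrow> coeff p j \<le> coeff p i"
proof -
  obtain m where inc: "\<And>i. i < m \<Longrightarrow> coeff p i \<le> coeff p (Suc i)"
    and dec: "\<And>i. \<lbrakk>m \<le> i; i < degree p\<rbrakk> \<Longrightarrow> coeff p (Suc i) \<le> coeff p i"
    using assms(1) unfolding unimodal_def by blast
  show thesis
  proof (rule that)
    show "coeff p i \<le> coeff p j" if "i \<le> j" "j \<le> m" for i j
      using that
    proof (induction j rule: dec_induct)
      case (step n)
      then show ?case using inc[of n] by simp
    qed simp
    \<comment> \<open>From the degree on, the next coefficient is 0, so nonnegativity extends the
      descent to all larger indices.\<close>
    have dec': "coeff p (Suc i) \<le> coeff p i" if "m \<le> i" for i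
      using dec[OF that] assms(2)[of i] by (cases "i < degree p") (auto simp: coeff_eq_0)
    show "coeff p j \<le> coeff p i" if "m \<le> i" "i \<le> j" for i j
      using that(2) by (induction j rule: dec_induct) (use that(1) dec' order_trans in force)+
  qed
qed

text \<open>Sliding the window by one gains the entry at \<open>Suc n\<close> and loses the one
  \<open>l\<close> places earlier. The conditional guards the truncated subtraction: while
  \<open>Suc n < l\<close>, nothing leaves the window.\<close>

lemma coeff_q_int_mult_diff:
  "coeff (q_int l * p) (Suc n) - coeff (q_int l * p) n
    = coeff p (Suc n) - (if Suc n < l then 0 else coeff p (Suc n - l))"
proof (induction l)
  case 0
  show ?case by (simp add: q_int_def)
next
  case (Suc l)
  have "q_int (Suc l) * p = q_int l * p + monom 1 l * p"
    by (simp add: q_int_def distrib_right)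
  with Suc show ?case
    by (auto simp: coeff_monom_mult)
qed

lemma coeff_0_q_int_mult: "0 < l \<Longrightarrow> coeff (q_int l * p) 0 = coeff p 0"
  by (simp add: q_int_def coeff_mult coeff_sum)

lemma coeff_q_int_mult_decreasing:
  assumes "unimodal p" "\<And>n. 0 \<le> coeff p n"
    and "i < j" "coeff (q_int l * p) (Suc i) < coeff (q_int l * p) i"
  shows "coeff (q_int l * p) (Suc j) \<le> coeff (q_int l * p) j"
proof -
  obtain m where inc: "\<And>i j. \<lbrakk>i \<le> j; j \<le> m\<rbrakk> \<Longrightarrow> coeff p i \<le> coeff p j"
    and dec: "\<And>i j. \<lbrakk>m \<le> i; i \<le> j\<rbrakk> \<Longrightarrow> coeff p j \<le> coeff p i"
    using unimodalE[OF assms(1,2)] by blast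
  \<comment> \<open>If nothing left the window, the difference would be a coefficient of
    \<open>p\<close>, hence nonnegative.\<close>
  have l: "l \<le> Suc i" and less: "coeff p (Suc i) < coeff p (Suc i - l)"
    using coeff_q_int_mult_diff[of l p i] assms(2)[of "Suc i"] assms(4)
    by (auto split: if_splits)
  \<comment> \<open>Otherwise both indices in \<open>less\<close> would lie on the ascending
    side.\<close>
  have m: "m \<le> Suc i"
    using inc[of "Suc i - l" "Suc i"] less by linarith
  have "coeff p (Suc j) \<le> coeff p (Suc j - l)"
  proof (cases "m \<le> Suc j - l")
    case True
    then show ?thesis by (intro dec) auto
  next
    case False
    \<comment> \<open>The entering indices lie past the mode and the leaving ones before it, so
      moving from \<open>i\<close> to \<open>j\<close> lowers the gain and raises the loss.\<close>
    have "coeff p (Suc j) \<le> coeff p (Suc i)"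
      using m assms(3) by (intro dec) auto
    also note less
    also have "coeff p (Suc i - l) \<le> coeff p (Suc j - l)"
      using False assms(3) by (intro inc) auto
    finally show ?thesis by simp
  qed
  then show ?thesis
    using coeff_q_int_mult_diff[of l p j] l assms(3) by simp
qed

lemma unimodal_rank_gen_poly: "\<kappa> \<in> compositions \<Longrightarrow> unimodal (rank_gen_poly \<kappa>)"
proof (induction \<kappa>)
  case Nil
  show ?case by (simp add: rank_gen_poly_Nil unimodal_def)
next
  case (Cons l \<gamma>)
  then have l: "0 < l" and uni: "unimodal (rank_gen_poly \<gamma>)"
    by (auto simp: compositions_def)
  let ?h = "q_int l * rank_gen_poly \<gamma>"
  have c0: "coeff (rank_gen_poly (l # \<gamma>)) 0 = coeff ?h 0"
    by (simp add: coeff_0_rank_gen_poly coeff_0_q_int_mult l)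
  have cS: "coeff (rank_gen_poly (l # \<gamma>)) (Suc n) = coeff ?h n" for n
    by (simp add: rank_gen_poly_Cons mult.assoc coeff_monom_mult)
  show ?case
  proof (rule unimodalI)
    fix i j
    assume ij: "i < j"
      and less: "coeff (rank_gen_poly (l # \<gamma>)) (Suc i) < coeff (rank_gen_poly (l # \<gamma>)) i"
    \<comment> \<open>The coefficients at 0 and 1 agree, so a strict descent cannot start at
      0.\<close>
    then obtain i' j' where "i = Suc i'" "j = Suc j'"
      using c0 cS[of 0] by (metis less_irrefl less_nat_zero_code not0_implies_Suc)
    then show "coeff (rank_gen_poly (l # \<gamma>)) (Suc j) \<le> coeff (rank_gen_poly (l # \<gamma>)) j"
      using coeff_q_int_mult_decreasing[OF uni coeff_rank_gen_poly_nonneg, of i' j' l] ij less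
      by (simp add: cS)
  qed
qed

theorem theorem3p3:
  shows "(\<forall>\<kappa>\<in>compositions. \<kappa> \<noteq> [] \<longrightarrow>
            rank_gen_poly \<kappa> = 1 + monom 1 1 * q_int (hd \<kappa>) * rank_gen_poly (tl \<kappa>)) \<and>
         (\<forall>\<kappa>\<in>compositions. unimodal (rank_gen_poly \<kappa>))"
  by (metis list.collapse rank_gen_poly_Cons unimodal_rank_gen_poly)

end
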